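(* Let $\mu>0$, let $a,b$ be real numbers with $b-a$ an integer $\ge 2$, and put $I=\{a+1,a+2,\dots,b-1\}$. Let $p,q,r:I\to\mathbb{R}$ with $p(t)>0$ and $r(t)>0$ for all $t\in I$. Then the discrete fractional Sturm-Liouville operator $L_1$ acting on $\ell^2(I)$ by $$L_1x(t)=\nabla_a^{\mu}\big(p(t)\,{}_b\nabla^{\mu}x(t)\big)+q(t)x(t),\qquad t\in I,$$ is self-adjoint, i.e. $\langle L_1u,v\rangle=\langle u,L_1v\rangle$ for all $u,v\in\ell^2(I)$.
   Context: $\ell^2(I)$ is the space of functions $x:I\to\mathbb{C}$ with inner product $\langle u,v\rangle=\sum_{s=a+1}^{b-1}u(s)\overline{v(s)}$. Notation: $\nabla x(t)=x(t)-x(t-1)$, $\Delta x(t)=x(t+1)-x(t)$, $\rho(t)=t-1$, and the rising function is $t^{\overline{\alpha}}=\Gamma(t+\alpha)/\Gamma(t)$. Let $n=\lfloor\mu\rfloor+1$. The (Riemann-Liouville) nabla left fractional difference of order $\mu$ is $$\nabla_a^{\mu}x(t)=\frac{1}{\Gamma(n-\mu)}\nabla^{n}\sum_{s=a+1}^{t}(t-\rho(s))^{\overline{n-\mu-1}}x(s),$$ where $\nabla^n$ acts in the variable $t$ and the sum is taken to be $0$ when $t\le a$. The (Riemann-Liouville) nabla right fractional difference of order $\mu$ is $${}_b\nabla^{\mu}x(t)=\frac{(-1)^n}{\Gamma(n-\mu)}\Delta^{n}\sum_{s=t}^{b-1}(s-\rho(t))^{\overline{n-\mu-1}}x(s),$$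 where $\Delta^n$ acts in the variable $t$ and the sum is taken to be $0$ when $t\ge b$. For $t\in I$ both expressions depend only on the values of $x$ on $I$. The expression $\nabla_a^{\mu}(p(t)\,{}_b\nabla^{\mu}x(t))$ means $\nabla_a^\mu$ applied to the function $t\mapsto p(t)\cdot({}_b\nabla^\mu x)(t)$ on $I$. *)

theory Defs
  imports "HOL-Analysis.Analysis"
begin

text \<open>The points \<open>c, c + 1, c + 2, \<dots>\<close> that do not exceed \<open>d\<close>; empty for \<open>d < c\<close>. Sums from
  \<open>c\<close> to \<open>d\<close> are sums over this set, so the empty-sum conventions for the fractional differences
  are automatic.\<close>

definition steps :: "real \<Rightarrow> real \<Rightarrow> real set" where
  "steps c d = {s. s - c \<in> \<int> \<and> c \<le> s \<and> s \<le> d}"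

lemma steps_eq_image: "steps c d = (\<lambda>k. c + real k) ` {k. c + real k \<le> d}"
proof (intro set_eqI iffI)
  fix s assume s: "s \<in> steps c d"
  then have "s - c \<in> \<nat>"
    by (simp add: steps_def Nats_altdef2)
  then obtain k where "s - c = real k"
    by (auto elim: Nats_cases)
  then have "s = c + real k" by simp
  with s show "s \<in> (\<lambda>k. c + real k) ` {k. c + real k \<le> d}"
    by (auto simp: steps_def)
qed (auto simp: steps_def)

lemma finite_steps [simp]: "finite (steps c d)"
proof -
  have "{k. c + real k \<le> d} \<subseteq> {..nat \<lceil>d - c\<rceil>}"
    by (auto simp: le_nat_iff) linarith
  then show ?thesis
    unfolding steps_eq_image by (meson finite_atMost finite_imageI finite_subset)
qed

lemma steps_empty [simp]: "d < c \<Longrightarrow> steps c d = {}"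
  by (auto simp: steps_def)

abbreviation interior_pts :: "real \<Rightarrow> real \<Rightarrow> real set" where
  "interior_pts a b \<equiv> steps (a + 1) (b - 1)"

text \<open>Complex functions on \<open>{a + 1, \<dots>, b - 1}\<close>, represented extensionally; the set is finite, so
  there is no summability condition.\<close>

definition ell2 :: "real \<Rightarrow> real \<Rightarrow> (real \<Rightarrow> complex) set" where
  "ell2 a b = interior_pts a b \<rightarrow>\<^sub>E UNIV"

definition ell2_inner :: "real \<Rightarrow> real \<Rightarrow> (real \<Rightarrow> complex) \<Rightarrow> (real \<Rightarrow> complex) \<Rightarrow> complex" where
  "ell2_inner a b u v = (\<Sum>s\<in>interior_pts a b. u s * cnj (v s))"

definition self_adjoint_ell2 ::
    "real \<Rightarrow> real \<Rightarrow> ((real \<Rightarrow> complex) \<Rightarrow> real \<Rightarrow> complex) \<Rightarrow> bool" where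
  "self_adjoint_ell2 a b L \<longleftrightarrow>
     (\<forall>u\<in>ell2 a b. \<forall>v\<in>ell2 a b. ell2_inner a b (L u) v = ell2_inner a b u (L v))"

definition rho :: "real \<Rightarrow> real" where
  "rho t = t - 1"

definition rising :: "real \<Rightarrow> real \<Rightarrow> real" where
  "rising t \<alpha> = Gamma (t + \<alpha>) / Gamma t"

definition nabla :: "(real \<Rightarrow> complex) \<Rightarrow> real \<Rightarrow> complex" where
  "nabla x t = x t - x (t - 1)"

definition delta :: "(real \<Rightarrow> complex) \<Rightarrow> real \<Rightarrow> complex" where
  "delta x t = x (t + 1) - x t"

definition frac_ord :: "real \<Rightarrow> nat" where
  "frac_ord \<mu> = nat (\<lfloor>\<mu>\<rfloor> + 1)"

text \<open>In both fractional differences the argument \<open>t\<close> is meant to lie in \<open>a + \<int>\<close>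
  (respectively \<open>b + \<int>\<close>). The first argument of \<^term>\<open>rising\<close> is then at least \<open>1\<close>, and its
  sum with the second is positive, so the poles of the Gamma function are never met.\<close>

definition nabla_left :: "real \<Rightarrow> real \<Rightarrow> (real \<Rightarrow> complex) \<Rightarrow> real \<Rightarrow> complex" where
  "nabla_left a \<mu> x t =
     (let n = frac_ord \<mu> in
       1 / of_real (Gamma (real n - \<mu>)) *
       (nabla ^^ n) (\<lambda>t. \<Sum>s\<in>steps (a + 1) t.
          of_real (rising (t - rho s) (real n - \<mu> - 1)) * x s) t)"

definition nabla_right :: "real \<Rightarrow> real \<Rightarrow> (real \<Rightarrow> complex) \<Rightarrow> real \<Rightarrow> complex" where
  "nabla_right b \<mu> x t =
     (let n = frac_ord \<mu> in
       (- 1) ^ n / of_real (Gamma (real n - \<mu>)) *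
       (delta ^^ n) (\<lambda>t. \<Sum>s\<in>steps t (b - 1).
          of_real (rising (s - rho t) (real n - \<mu> - 1)) * x s) t)"

definition L1 ::
    "real \<Rightarrow> real \<Rightarrow> real \<Rightarrow> (real \<Rightarrow> real) \<Rightarrow> (real \<Rightarrow> real) \<Rightarrow> (real \<Rightarrow> complex) \<Rightarrow> real \<Rightarrow> complex" where
  "L1 \<mu> a b p q x =
     (\<lambda>t\<in>interior_pts a b.
        nabla_left a \<mu> (\<lambda>s\<in>interior_pts a b. of_real (p s) * nabla_right b \<mu> x s) t
        + of_real (q t) * x t)"

lemma L1_in_ell2: "L1 \<mu> a b p q x \<in> ell2 a b"
  by (simp add: L1_def ell2_def)

end

theory Submission
  imports Defs
begin

text \<open>On \<open>I\<close>, the left difference is convolution with a real kernel \<open>K(t - s)\<close>, where \<open>K\<close> is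
  \<open>\<nabla>\<^sup>n\<close> of the rising function extended by \<open>0\<close>, divided by \<open>\<Gamma>(n - \<mu>)\<close>. The right difference has the
  kernel \<open>K(s - t)\<close>: each \<open>\<Delta>\<close> in \<open>t\<close> is \<open>-\<nabla>\<close> in \<open>s - t\<close>, and the factor \<open>(-1)\<^sup>n\<close> cancels the signs.
  So the two are mutually adjoint, and \<open>\<langle>L\<^sub>1u, v\<rangle>\<close> is the Hermitian form
  \<open>\<Sum>p \<cdot> (\<^sub>b\<nabla>\<^sup>\<mu>u) \<cdot> cnj (\<^sub>b\<nabla>\<^sup>\<mu>v) + \<Sum>q \<cdot> u \<cdot> cnj v\<close>.\<close>

lemma funpow_nabla_Reals:
  assumes "\<And>d. G d \<in> \<real>"
  shows "(nabla ^^ n) G d \<in> \<real>"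
  using assms by (induction n arbitrary: d) (auto simp: nabla_def)

text \<open>Convolution commutes with shifts of \<open>t\<close>. Since \<open>nabla\<close> only
  looks backwards, it never leaves the half-line \<open>t \<le> c\<close>.\<close>

lemma funpow_nabla_convolution:
  assumes F: "\<And>t. t \<le> c \<Longrightarrow> F t = (\<Sum>s\<in>A. G (t - s) * x s)"
    and "t \<le> c"
  shows "(nabla ^^ n) F t = (\<Sum>s\<in>A. (nabla ^^ n) G (t - s) * x s)"
  using \<open>t \<le> c\<close>
proof (induction n arbitrary: t)
  case (Suc n)
  have "nabla H (t - s) = H (t - s) - H (t - 1 - s)" for H s
    by (simp add: nabla_def algebra_simps)
  with Suc show ?case
    by (simp add: nabla_def[of "(nabla ^^ n) F"] sum_subtractf left_diff_distrib)
qed (simp add: F)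

text \<open>\<open>delta\<close> looks forward and stays within \<open>c\<close>,
  \<open>c + 1\<close>, and so on. Raising \<open>t\<close> by 1 lowers \<open>s - t\<close> by 1,
  whence one sign per difference.\<close>

lemma funpow_delta_convolution:
  assumes F: "\<And>t. \<lbrakk>t - c \<in> \<int>; c \<le> t\<rbrakk> \<Longrightarrow> F t = (\<Sum>s\<in>A. G (s - t) * x s)"
    and "t - c \<in> \<int>" "c \<le> t"
  shows "(delta ^^ n) F t = (- 1) ^ n * (\<Sum>s\<in>A. (nabla ^^ n) G (s - t) * x s)"
  using assms(2,3)
proof (induction n arbitrary: t)
  case (Suc n)
  have "t + 1 - c \<in> \<int>"
    using Ints_add[OF Suc.prems(1) Ints_1] by (simp add: algebra_simps)
  moreover have "nabla H (s - t) = H (s - t) - H (s - (t + 1))" for H s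
    by (simp add: nabla_def diff_diff_eq)
  ultimately show ?case
    using Suc by (simp add: delta_def sum_subtractf left_diff_distrib right_diff_distrib)
qed (simp add: F)

lemma steps_upper_restrict: "t \<le> d \<Longrightarrow> steps c t = {s \<in> steps c d. s \<le> t}"
  by (auto simp: steps_def)

text \<open>\<open>steps\<close> is anchored at its lower end, so an integer shift of that end keeps
  the same lattice.\<close>

lemma steps_lower_restrict:
  assumes "t - c \<in> \<int>" "c \<le> t"
  shows "steps t d = {s \<in> steps c d. t \<le> s}"
proof -
  have "s - t \<in> \<int> \<longleftrightarrow> s - c \<in> \<int>" for s
    using Ints_add[OF _ assms(1), of "s - t"] Ints_diff[OF _ assms(1), of "s - c"] by auto
  with assms(2) show ?thesis by (auto simp: steps_def)
qed

text \<open>Extension by zero absorbs the variable summation limit; \<open>d + 1\<close> comes from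
  \<open>t - rho s = (t - s) + 1\<close>.\<close>

definition rising_kernel :: "real \<Rightarrow> real \<Rightarrow> complex" where
  "rising_kernel \<alpha> d = (if 0 \<le> d then of_real (rising (d + 1) \<alpha>) else 0)"

definition frac_kernel :: "real \<Rightarrow> real \<Rightarrow> complex" where
  "frac_kernel \<mu> d =
     (let n = frac_ord \<mu> in
       (nabla ^^ n) (rising_kernel (real n - \<mu> - 1)) d / of_real (Gamma (real n - \<mu>)))"

text \<open>Lets the kernel pass through the conjugation in the second slot of the inner
  product.\<close>

lemma cnj_frac_kernel [simp]: "cnj (frac_kernel \<mu> d) = frac_kernel \<mu> d"
proof -
  have "frac_kernel \<mu> d \<in> \<real>"
    unfolding frac_kernel_def Let_def
    by (intro Reals_divide funpow_nabla_Reals) (auto simp: rising_kernel_def)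
  then show ?thesis by (simp add: Reals_cnj_iff)
qed

lemma nabla_left_convolution:
  assumes "t \<in> interior_pts a b"
  shows "nabla_left a \<mu> x t = (\<Sum>s\<in>interior_pts a b. frac_kernel \<mu> (t - s) * x s)"
proof -
  define n where "n = frac_ord \<mu>"
  define \<alpha> where "\<alpha> = real n - \<mu> - 1"
  have "(\<Sum>s\<in>steps (a + 1) t. of_real (rising (t - rho s) \<alpha>) * x s)
      = (\<Sum>s\<in>interior_pts a b. rising_kernel \<alpha> (t - s) * x s)" if "t \<le> b - 1" for t
    unfolding steps_upper_restrict[OF that] sum.inter_filter[OF finite_steps]
    by (intro sum.cong) (auto simp: rising_kernel_def rho_def algebra_simps)
  moreover have "t \<le> b - 1" using assms by (simp add: steps_def)
  ultimately show ?thesis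
    using funpow_nabla_convolution[where c = "b - 1" and t = t and n = n]
    by (simp add: nabla_left_def frac_kernel_def Let_def sum_divide_distrib
        flip: n_def \<alpha>_def)
qed

lemma nabla_right_convolution:
  assumes "t \<in> interior_pts a b"
  shows "nabla_right b \<mu> x t = (\<Sum>s\<in>interior_pts a b. frac_kernel \<mu> (s - t) * x s)"
proof -
  define n where "n = frac_ord \<mu>"
  define \<alpha> where "\<alpha> = real n - \<mu> - 1"
  let ?F = "\<lambda>t. \<Sum>s\<in>steps t (b - 1). of_real (rising (s - rho t) \<alpha>) * x s"
  have F: "?F t = (\<Sum>s\<in>interior_pts a b. rising_kernel \<alpha> (s - t) * x s)"
    if "t - (a + 1) \<in> \<int>" "a + 1 \<le> t" for t
    unfolding steps_lower_restrict[OF that] sum.inter_filter[OF finite_steps]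
    by (intro sum.cong) (auto simp: rising_kernel_def rho_def algebra_simps)
  have "t - (a + 1) \<in> \<int>" "a + 1 \<le> t" using assms by (simp_all add: steps_def)
  from funpow_delta_convolution[where F = ?F, OF F this]
  have "(delta ^^ n) ?F t
      = (- 1) ^ n * (\<Sum>s\<in>interior_pts a b. (nabla ^^ n) (rising_kernel \<alpha>) (s - t) * x s)" .
  then show ?thesis
    \<comment> \<open>The flipped \<open>power_mult_distrib\<close> merges both factors
      \<open>(- 1) ^ n\<close> into \<open>((- 1) * (- 1)) ^ n = 1\<close>.\<close>
    by (simp add: nabla_right_def frac_kernel_def Let_def sum_divide_distrib
        flip: n_def \<alpha>_def power_mult_distrib mult.assoc)
qed

lemma ell2_inner_nabla_left:
  "ell2_inner a b (nabla_left a \<mu> x) v = ell2_inner a b x (nabla_right b \<mu> v)"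
proof -
  let ?I = "interior_pts a b"
  have "ell2_inner a b (nabla_left a \<mu> x) v
      = (\<Sum>t\<in>?I. \<Sum>s\<in>?I. frac_kernel \<mu> (t - s) * x s * cnj (v t))"
    by (simp add: ell2_inner_def nabla_left_convolution sum_distrib_right cong: sum.cong)
  also have "\<dots> = (\<Sum>s\<in>?I. \<Sum>t\<in>?I. frac_kernel \<mu> (t - s) * x s * cnj (v t))"
    by (rule sum.swap)
  also have "\<dots> = ell2_inner a b x (nabla_right b \<mu> v)"
    by (simp add: ell2_inner_def nabla_right_convolution sum_distrib_left mult_ac cong: sum.cong)
  finally show ?thesis .
qed

lemma ell2_inner_L1_left:
  "ell2_inner a b (L1 \<mu> a b p q u) v =
     (\<Sum>s\<in>interior_pts a b. of_real (p s) * nabla_right b \<mu> u s * cnj (nabla_right b \<mu> v s))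
     + (\<Sum>s\<in>interior_pts a b. of_real (q s) * u s * cnj (v s))"
proof -
  let ?w = "\<lambda>s\<in>interior_pts a b. of_real (p s) * nabla_right b \<mu> u s"
  have "ell2_inner a b (L1 \<mu> a b p q u) v = ell2_inner a b (nabla_left a \<mu> ?w) v
      + (\<Sum>s\<in>interior_pts a b. of_real (q s) * u s * cnj (v s))"
    by (simp add: ell2_inner_def L1_def distrib_right sum.distrib cong: sum.cong)
  then show ?thesis
    unfolding ell2_inner_nabla_left by (simp add: ell2_inner_def cong: sum.cong)
qed

lemma ell2_inner_commute: "ell2_inner a b u v = cnj (ell2_inner a b v u)"
  by (simp add: ell2_inner_def mult.commute)

theorem theorem9:
  fixes \<mu> a b :: real and p q r :: "real \<Rightarrow> real"
  assumes "\<mu> > 0"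
    and "b - a \<in> \<int>" and "b - a \<ge> 2"
    and "\<And>t. t \<in> interior_pts a b \<Longrightarrow> p t > 0"
    and "\<And>t. t \<in> interior_pts a b \<Longrightarrow> r t > 0"
  shows "self_adjoint_ell2 a b (L1 \<mu> a b p q)"
  unfolding self_adjoint_ell2_def
proof (intro ballI)
  fix u v
  show "ell2_inner a b (L1 \<mu> a b p q u) v = ell2_inner a b u (L1 \<mu> a b p q v)"
    \<comment> \<open>As \<open>p\<close> and \<open>q\<close> are real-valued, conjugating the form
      with \<open>u\<close> and \<open>v\<close> exchanged gives it back.\<close>
    unfolding ell2_inner_commute[of a b u "L1 \<mu> a b p q v"] ell2_inner_L1_left
    by (simp add: mult_ac)
qed

end
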